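(* Let $\mathfrak{g}$ be an associative complex algebra with unit, equipped with a trace $\mathrm{Tr}\colon\mathfrak{g}\to\mathbb{C}$, i.e. a linear form with $\mathrm{Tr}(X\cdot Y)=\mathrm{Tr}(Y\cdot X)$ for all $X,Y\in\mathfrak{g}$. Let $\mathcal{A}_k$ be the standard polynomials on $\mathfrak{g}$. Then $\mathrm{Tr}(\mathcal{A}_{2k})=0$ for all $k\ge1$, and for all $k\ge0$, $\mathrm{Tr}(\mathcal{A}_{2k+1})$ is an invariant cocycle for the cohomology with trivial coefficients of the Lie algebra $\mathfrak{g}$ (with Lie bracket $[X,Y]=X\cdot Y-Y\cdot X$).
   Context: Standard polynomials: for $k\ge1$, $\mathcal{A}_k\colon\mathfrak{g}^k\to\mathfrak{g}$ is $\mathcal{A}_k(Y_1,\dots,Y_k)=\sum_{\sigma\in\mathfrak{S}_k}\varepsilon(\sigma)\,Y_{\sigma(1)}\cdots Y_{\sigma(k)}$, where $\varepsilon(\sigma)$ is the signature and the product is that of $\mathfrak{g}$. $\bigwedge^p\mathfrak{g}$ denotes the space of skew symmetric $p$-linear forms on $\mathfrak{g}$ ($\mathfrak{g}$ possibly infinite dimensional). For a skew symmetric $p$-linear $F\colon\mathfrak{g}^p\to\mathfrak{g}$, $\mathrm{Tr}(F)\in\bigwedge^p\mathfrak{g}$ is $\mathrm{Tr}(F)(Y_1,\dots,Y_p)=\mathrm{Tr}(F(Y_1,\dots,Y_p))$. The Chevalley differential is $\partial\Omega(Y_1,\dots,Y_{p+1})=\sum_{i<j}(-1)^{i+j}\Omega([Y_i,Y_j],Y_1,\dots,\widehat{Y_i},\dots,\widehat{Y_j},\dots,Y_{p+1})$,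 $\Omega\in\bigwedge^p\mathfrak{g}$; a cocycle satisfies $\partial\Omega=0$. $\Omega$ is invariant if $\sum_i\Omega(Y_1,\dots,[X,Y_i],\dots,Y_p)=0$ for all $X,Y_1,\dots,Y_p\in\mathfrak{g}$. *)

theory Defs
  imports Complex_Main "HOL-Combinatorics.Permutations"
begin

text \<open>The class \<open>ring_1\<close> would impose \<open>0 \<noteq> 1\<close>; the sort \<open>{ring, monoid_mult}\<close> describes
  unital rings including the zero ring.\<close>

locale complex_algebra = vector_space scale
  for scale :: "complex \<Rightarrow> 'a::{ring, monoid_mult} \<Rightarrow> 'a" +
  assumes scale_mult_left: "scale c x * y = scale c (x * y)"
    and scale_mult_right: "x * scale c y = scale c (x * y)"

definition is_trace ::
    "(complex \<Rightarrow> 'a::{ring, monoid_mult} \<Rightarrow> 'a) \<Rightarrow> ('a \<Rightarrow> complex) \<Rightarrow> bool" where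
  "is_trace scale Tr \<longleftrightarrow>
     Vector_Spaces.linear scale (*) Tr \<and> (\<forall>X Y. Tr (X * Y) = Tr (Y * X))"

definition commutator :: "'a::ring \<Rightarrow> 'a \<Rightarrow> 'a" where
  "commutator X Y = X * Y - Y * X"

text \<open>Functions of \<open>p\<close> arguments are functions on lists, considered only on lists of length \<open>p\<close>.
  Positions are counted from 0; this does not affect the signs \<open>(-1)^(i+j)\<close> below.\<close>

definition standard_poly ::
    "(complex \<Rightarrow> 'a::{ring, monoid_mult} \<Rightarrow> 'a) \<Rightarrow> nat \<Rightarrow> 'a list \<Rightarrow> 'a" where
  "standard_poly scale k Ys =
     (\<Sum>\<sigma> | \<sigma> permutes {..<k}. scale (of_int (sign \<sigma>)) (prod_list (permute_list \<sigma> Ys)))"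

definition alternating_forms ::
    "(complex \<Rightarrow> 'a::ab_group_add \<Rightarrow> 'a) \<Rightarrow> nat \<Rightarrow> ('a list \<Rightarrow> complex) set" where
  "alternating_forms scale p = {\<Omega>.
     (\<forall>Ys i. length Ys = p \<and> i < p \<longrightarrow>
        Vector_Spaces.linear scale (*) (\<lambda>X. \<Omega> (Ys[i := X]))) \<and>
     (\<forall>Ys \<sigma>. length Ys = p \<and> \<sigma> permutes {..<p} \<longrightarrow>
        \<Omega> (permute_list \<sigma> Ys) = of_int (sign \<sigma>) * \<Omega> Ys)}"

text \<open>\<open>nths Ys (- {i, j})\<close> is the list \<open>Ys\<close> with the entries at positions \<open>i\<close> and \<open>j\<close> omitted.\<close>

definition chevalley_differential ::
    "('a \<Rightarrow> 'a \<Rightarrow> 'a) \<Rightarrow> nat \<Rightarrow> ('a list \<Rightarrow> complex) \<Rightarrow> 'a list \<Rightarrow> complex" where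
  "chevalley_differential bracket p \<Omega> Ys =
     (\<Sum>(i, j) | i < j \<and> j < p + 1.
        (-1) ^ (i + j) * \<Omega> (bracket (Ys ! i) (Ys ! j) # nths Ys (- {i, j})))"

definition is_cocycle ::
    "(complex \<Rightarrow> 'a::ab_group_add \<Rightarrow> 'a) \<Rightarrow> ('a \<Rightarrow> 'a \<Rightarrow> 'a) \<Rightarrow> nat \<Rightarrow> ('a list \<Rightarrow> complex) \<Rightarrow> bool" where
  "is_cocycle scale bracket p \<Omega> \<longleftrightarrow> \<Omega> \<in> alternating_forms scale p \<and>
     (\<forall>Ys. length Ys = p + 1 \<longrightarrow> chevalley_differential bracket p \<Omega> Ys = 0)"

definition is_invariant_form ::
    "('a \<Rightarrow> 'a \<Rightarrow> 'a) \<Rightarrow> nat \<Rightarrow> ('a list \<Rightarrow> complex) \<Rightarrow> bool" where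
  "is_invariant_form bracket p \<Omega> \<longleftrightarrow>
     (\<forall>X Ys. length Ys = p \<longrightarrow> (\<Sum>i<p. \<Omega> (Ys[i := bracket X (Ys ! i)])) = 0)"

end

theory Submission
  imports Defs
begin

text \<open>Antisymmetrising a cyclically invariant function over an even number of arguments gives zero,
  because a cycle of even length is odd. Invariance holds because \<open>Y \<mapsto> [X, Y]\<close> is a derivation, so
  the alternating sum consists of traces of commutators. Finally, every invariant alternating form
  \<open>\<Omega>\<close> is a cocycle: inserting \<open>X = Y\<^sub>i\<close> into the invariance identity for the remaining arguments,
  and summing over \<open>i\<close> with signs, gives \<open>-2 \<partial>\<Omega> = 0\<close>.\<close>

subsection \<open>Permutations and updates of lists\<close>

text \<open>The cycle 0 -> 1 -> ... -> m -> 0 is built from \<open>m\<close> adjacent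
  transpositions, one per induction step, so its sign comes out of multiplicativity.\<close>

lemma ex_cycle_to_front:
  assumes "m < n"
  obtains \<rho> where "\<rho> permutes {..<n}" "sign \<rho> = (-1) ^ m"
    "\<And>i. \<rho> i = (if i < m then Suc i else if i = m then 0 else i)"
proof -
  have "\<exists>\<rho>. \<rho> permutes {..<n} \<and> sign \<rho> = (-1) ^ m \<and>
      (\<forall>i. \<rho> i = (if i < m then Suc i else if i = m then 0 else i))"
    using assms
  proof (induction m)
    case 0
    then show ?case
      by (intro exI[of _ id] conjI permutes_id) (simp_all add: sign_id)
  next
    case (Suc m)
    then obtain \<rho> where \<rho>: "\<rho> permutes {..<n}" "sign \<rho> = (-1) ^ m"
      "\<And>i. \<rho> i = (if i < m then Suc i else if i = m then 0 else i)"
      by auto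
    let ?t = "Transposition.transpose m (Suc m)"
    have t: "?t permutes {..<n}"
      using Suc.prems by (intro permutes_swap_id) auto
    have "permutation \<rho>" "permutation ?t"
      using \<rho>(1) t by (auto intro: permutation_permutes[THEN iffD2])
    then have "sign (\<rho> \<circ> ?t) = (-1) ^ Suc m"
      by (simp add: sign_compose \<rho>(2) sign_swap_id)
    moreover have "(\<rho> \<circ> ?t) i = (if i < Suc m then Suc i else if i = Suc m then 0 else i)" for i
      by (auto simp: \<rho>(3) Transposition.transpose_def)
    moreover have "\<rho> \<circ> ?t permutes {..<n}"
      using permutes_compose[OF t \<rho>(1)] .
    ultimately show ?case by blast
  qed
  then show thesis using that by blast
qed

text \<open>Since \<open>permute_list \<rho> Ys\<close> has entry \<open>Ys ! \<rho> i\<close> at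
  position \<open>i\<close>, the cycle above carries the head to position \<open>m\<close>. The
  permutation depends only on the two lengths, so a single one serves for all lists; this is what
  allows it to reindex a sum over all permutations later.\<close>

lemma ex_permute_list_move_front:
  obtains \<rho> where "\<rho> permutes {..<Suc (m + l)}" "sign \<rho> = (-1) ^ m"
    "\<And>y xs zs. length xs = m \<Longrightarrow> length zs = l \<Longrightarrow> permute_list \<rho> (y # xs @ zs) = xs @ y # zs"
proof -
  obtain \<rho> where \<rho>: "\<rho> permutes {..<Suc (m + l)}" "sign \<rho> = (-1) ^ m"
    "\<And>i. \<rho> i = (if i < m then Suc i else if i = m then 0 else i)"
    using ex_cycle_to_front[of m "Suc (m + l)"] by auto
  have "permute_list \<rho> (y # xs @ zs) = xs @ y # zs"
    if "length xs = m" "length zs = l" for y :: 'a and xs zs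
    using that by (intro nth_equalityI)
      (auto simp: permute_list_nth \<rho> nth_append nth_Cons Suc_diff_Suc Suc_diff_le split: nat.splits
        intro: arg_cong[where f = "nth zs"])
  then show thesis using that \<rho> by blast
qed

text \<open>Position \<open>j\<close> of the permuted list reads position \<open>\<sigma> j\<close>
  of the original. Indexing the update by \<open>\<sigma> j\<close> avoids inverses and fits sums
  that have been reindexed along \<open>\<sigma>\<close>.\<close>

lemma permute_list_list_update:
  assumes "\<sigma> permutes {..<length Ys}" "j < length Ys"
  shows "permute_list \<sigma> (Ys[\<sigma> j := X]) = (permute_list \<sigma> Ys)[j := X]"
proof (rule nth_equalityI)
  fix i assume "i < length (permute_list \<sigma> (Ys[\<sigma> j := X]))"
  then have i: "i < length Ys" by simp
  have "\<sigma> i < length Ys" "\<sigma> j < length Ys"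
    using permutes_in_image[OF assms(1)] i assms(2) by auto
  moreover have "\<sigma> i = \<sigma> j \<longleftrightarrow> i = j"
    using permutes_inj[OF assms(1)] by (auto dest: injD)
  ultimately show "permute_list \<sigma> (Ys[\<sigma> j := X]) ! i = (permute_list \<sigma> Ys)[j := X] ! i"
    using i assms by (auto simp: permute_list_nth nth_list_update)
qed simp

lemma prod_list_list_update:
  fixes Ys :: "'a::monoid_mult list"
  assumes "j < length Ys"
  shows "prod_list (Ys[j := X]) = prod_list (take j Ys) * X * prod_list (drop (Suc j) Ys)"
  using assms by (simp add: upd_conv_take_nth_drop mult.assoc)

subsection \<open>Invariant alternating forms are cocycles\<close>

lemma alternating_forms_move_front:
  assumes "\<Omega> \<in> alternating_forms scale p" "p = Suc (length xs + length zs)"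
  shows "\<Omega> (xs @ y # zs) = (-1) ^ length xs * \<Omega> (y # xs @ zs)"
proof -
  obtain \<rho> where \<rho>: "\<rho> permutes {..<p}" "sign \<rho> = (-1) ^ length xs"
    "permute_list \<rho> (y # xs @ zs) = xs @ y # zs"
    using ex_permute_list_move_front[of "length xs" "length zs"] assms(2) by metis
  have "\<Omega> (permute_list \<rho> (y # xs @ zs)) = of_int (sign \<rho>) * \<Omega> (y # xs @ zs)"
    using assms \<rho>(1) unfolding alternating_forms_def by simp
  then show ?thesis using \<rho> by simp
qed

lemma nths_Compl_nth: "nths (xs @ y # zs) (- {length xs}) = xs @ zs"
proof -
  have "nths xs (- {length xs}) = xs" by (rule nths_all) auto
  moreover have "nths zs {j. Suc (j + length xs) \<in> - {length xs}} = zs" by (rule nths_all) auto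
  ultimately show ?thesis by (simp add: nths_append nths_Cons)
qed

lemma nths_Compl_nth2:
  "nths (xs @ a # ys @ b # zs) (- {length xs, Suc (length xs + length ys)}) = xs @ ys @ zs"
proof -
  let ?A = "- {length xs, Suc (length xs + length ys)}"
  have "nths xs ?A = xs" by (rule nths_all) auto
  \<comment> \<open>Once the indices are shifted past \<open>xs\<close> and \<open>a\<close>, the
    only position still to be omitted is that of \<open>b\<close>, which is the one-entry
    case.\<close>
  moreover have "{j. Suc j \<in> {j. j + length xs \<in> ?A}} = - {length ys}" by auto
  ultimately show ?thesis
    by (simp add: nths_append[of xs] nths_Cons[of a] nths_Compl_nth)
qed

lemma split_list_nth2:
  assumes "i < j" "j < length Ys"
  obtains xs ys zs where "Ys = xs @ Ys ! i # ys @ Ys ! j # zs" "length xs = i"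
    "j = Suc (i + length ys)"
proof
  show "Ys = take i Ys @ Ys ! i # take (j - Suc i) (drop (Suc i) Ys) @ Ys ! j # drop (Suc j) Ys"
    using assms id_take_nth_drop[of i Ys] id_take_nth_drop[of "j - Suc i" "drop (Suc i) Ys"] by simp
qed (use assms in auto)

text \<open>This is invariance with \<open>X = Ys ! i\<close>, applied to the \<open>p\<close>
  entries of \<open>Ys\<close> other than the one at position \<open>i\<close>. Moving each bracket
  to the front costs the sign of its position in the shortened list. Beyond \<open>i\<close> that
  position is one less than in \<open>Ys\<close>, so the two halves of the sum receive opposite
  signs.\<close>

lemma invariant_alternating_form_identity:
  assumes alt: "\<Omega> \<in> alternating_forms scale p" and inv: "is_invariant_form bracket p \<Omega>"
    and len: "length Ys = Suc p" and i: "i \<le> p"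
  defines "T \<equiv> \<lambda>j. \<Omega> (bracket (Ys ! i) (Ys ! j) # nths Ys (- {i, j}))"
  shows "(\<Sum>j<i. (-1) ^ j * T j) = (\<Sum>j\<in>{i<..p}. (-1) ^ j * T j)"
proof -
  define Zs where "Zs = take i Ys @ drop (Suc i) Ys"
  define g where "g m = \<Omega> (Zs[m := bracket (Ys ! i) (Zs ! m)])" for m
  have "length Zs = p" using len i by (simp add: Zs_def)
  then have sum0: "(\<Sum>m<p. g m) = 0"
    using inv unfolding is_invariant_form_def g_def by blast
  have low: "g j = (-1) ^ j * T j" if "j < i" for j
  proof -
    have "i < length Ys" using len i by simp
    with that obtain xs ys zs where Ys: "Ys = xs @ Ys ! j # ys @ Ys ! i # zs" "length xs = j"
      "i = Suc (j + length ys)"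
      by (rule split_list_nth2)
    have "length Ys = Suc (Suc (length xs + length ys + length zs))" by (subst Ys(1)) simp
    then have p: "p = Suc (length xs + length (ys @ zs))" using len by simp
    obtain a b where ab: "a = Ys ! j" "b = Ys ! i" by blast
    have Ys': "Ys = xs @ a # ys @ b # zs" using Ys(1) ab by simp
    have Zs: "Zs = xs @ a # ys @ zs"
      unfolding Zs_def Ys' using Ys(2,3) by simp
    have "nths Ys (- {i, j}) = xs @ ys @ zs"
      using nths_Compl_nth2[of xs a ys b zs] Ys(2,3) Ys' by (simp add: insert_commute)
    moreover have "g j = \<Omega> (xs @ bracket b a # (ys @ zs))"
      unfolding g_def Zs ab(2)[symmetric] using Ys(2) by (simp add: list_update_append nth_append)
    ultimately show ?thesis
      using alternating_forms_move_front[OF alt p] Ys(2) by (simp add: T_def ab)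
  qed
  \<comment> \<open>Entry \<open>j\<close> of \<open>Zs\<close> is entry \<open>Suc j\<close> of
    \<open>Ys\<close> here; this shift produces the minus sign.\<close>
  have high: "g j = - ((-1) ^ Suc j * T (Suc j))" if "i \<le> j" "j < p" for j
  proof -
    have "i < Suc j" "Suc j < length Ys" using that len by simp_all
    then obtain xs ys zs where Ys: "Ys = xs @ Ys ! i # ys @ Ys ! Suc j # zs" "length xs = i"
      "Suc j = Suc (i + length ys)"
      by (rule split_list_nth2)
    have "length Ys = Suc (Suc (length xs + length ys + length zs))" by (subst Ys(1)) simp
    then have p: "p = Suc (length (xs @ ys) + length zs)" using len by simp
    obtain a b where ab: "a = Ys ! i" "b = Ys ! Suc j" by blast
    have Ys': "Ys = xs @ a # ys @ b # zs" using Ys(1) ab by simp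
    have Zs: "Zs = (xs @ ys) @ b # zs"
      unfolding Zs_def Ys' using Ys(2) by simp
    have "nths Ys (- {i, Suc j}) = xs @ ys @ zs"
      using nths_Compl_nth2[of xs a ys b zs] Ys(2,3) Ys' by simp
    moreover have "g j = \<Omega> ((xs @ ys) @ bracket a b # zs)"
      unfolding g_def Zs ab(1)[symmetric] using Ys(2,3)
      by (simp add: list_update_append nth_append)
    ultimately show ?thesis
      using alternating_forms_move_front[OF alt p] Ys(2,3) by (simp add: T_def ab)
  qed
  have "{..<p} = {..<i} \<union> {i..<p}" using i by auto
  then have "(\<Sum>m<p. g m) = (\<Sum>m<i. g m) + (\<Sum>m=i..<p. g m)"
    by (simp add: sum.union_disjoint ivl_disj_int)
  also have "(\<Sum>m<i. g m) = (\<Sum>j<i. (-1) ^ j * T j)"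
    using low by simp
  also have "(\<Sum>m=i..<p. g m) = (\<Sum>m=i..<p. - ((-1) ^ Suc m * T (Suc m)))"
    by (rule sum.cong) (auto simp: high)
  also have "\<dots> = - (\<Sum>j=Suc i..<Suc p. (-1) ^ j * T j)"
    by (subst sum.shift_bounds_Suc_ivl) (simp add: sum_negf)
  also have "{Suc i..<Suc p} = {i<..p}" by auto
  finally show ?thesis using sum0 by simp
qed

text \<open>Multiplying the preceding identity by \<open>(-1) ^ i\<close> and summing over
  \<open>i\<close> equates the sum over pairs \<open>i < j\<close>, which is the differential, with
  the sum over pairs \<open>j < i\<close>. Antisymmetry of the bracket makes the latter its
  negative.\<close>

lemma invariant_alternating_form_is_cocycle:
  assumes alt: "\<Omega> \<in> alternating_forms scale p" and inv: "is_invariant_form bracket p \<Omega>"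
    and antisym: "\<And>X Y. bracket X Y = - bracket Y X"
  shows "is_cocycle scale bracket p \<Omega>"
  unfolding is_cocycle_def
proof (intro conjI allI impI)
  fix Ys :: "'a list" assume "length Ys = p + 1"
  then have len: "length Ys = Suc p" by simp
  define T where "T i j = \<Omega> (bracket (Ys ! i) (Ys ! j) # nths Ys (- {i, j}))" for i j
  define S where "S = (\<Sum>i\<le>p. \<Sum>j\<in>{i<..p}. (-1) ^ (i + j) * T i j)"
  have T_swap: "T j i = - T i j" if "i < j" "j \<le> p" for i j
  proof -
    let ?r = "nths Ys (- {i, j})"
    have "j < length Ys" using that len by simp
    with \<open>i < j\<close> obtain xs ys zs where Ys: "Ys = xs @ Ys ! i # ys @ Ys ! j # zs"
      "length xs = i" "j = Suc (i + length ys)"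
      by (rule split_list_nth2)
    have "length Ys = Suc (Suc (length xs + length ys + length zs))" by (subst Ys(1)) simp
    moreover have "?r = xs @ ys @ zs"
      using nths_Compl_nth2[of xs "Ys ! i" ys "Ys ! j" zs] Ys by simp
    ultimately have len_r: "Suc (length ?r) = p" using len by simp
    have "\<forall>Ys k. length Ys = p \<and> k < p \<longrightarrow>
        Vector_Spaces.linear scale (*) (\<lambda>X. \<Omega> (Ys[k := X]))"
      using alt unfolding alternating_forms_def by blast
    \<comment> \<open>The entry \<open>undefined\<close> is only a placeholder for the slot that the
      update overwrites; the result is linearity in the first argument, used to pull out the sign of
      the bracket.\<close>
    from this[rule_format, of "undefined # ?r" 0]
    have "Vector_Spaces.linear scale (*) (\<lambda>X. \<Omega> (X # ?r))"
      using len_r by simp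
    then interpret Vector_Spaces.linear scale "(*)" "\<lambda>X. \<Omega> (X # ?r)" .
    have "\<Omega> (bracket (Ys ! j) (Ys ! i) # ?r) = - \<Omega> (bracket (Ys ! i) (Ys ! j) # ?r)"
      by (subst antisym) (rule neg)
    then show ?thesis unfolding T_def by (simp add: insert_commute)
  qed
  have "{(i, j). i < j \<and> j < p + 1} = Sigma {..p} (\<lambda>i. {i<..p})" by auto
  then have S: "chevalley_differential bracket p \<Omega> Ys = S"
    unfolding chevalley_differential_def S_def T_def by (simp add: sum.Sigma)
  have "S = (\<Sum>i\<le>p. (-1) ^ i * (\<Sum>j\<in>{i<..p}. (-1) ^ j * T i j))"
    unfolding S_def by (simp add: sum_distrib_left power_add mult.assoc)
  also have "\<dots> = (\<Sum>i\<le>p. (-1) ^ i * (\<Sum>j<i. (-1) ^ j * T i j))"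
    using invariant_alternating_form_identity[OF alt inv len] unfolding T_def by simp
  also have "\<dots> = (\<Sum>i\<le>p. \<Sum>j<i. (-1) ^ (i + j) * T i j)"
    by (simp add: sum_distrib_left power_add mult.assoc)
  \<comment> \<open>The pairs are regrouped by their smaller index. Up to renaming, this is
    \<open>S\<close> with the arguments of \<open>T\<close> exchanged, so \<open>T_swap\<close>
    applies to every term.\<close>
  also have "\<dots> = (\<Sum>j\<le>p. \<Sum>i\<in>{j<..p}. (-1) ^ (i + j) * T i j)"
    by (simp add: sum.Sigma)
      (rule sum.reindex_bij_witness[of _ prod.swap prod.swap]; auto)
  also have "\<dots> = - S"
    unfolding S_def sum_negf[symmetric] by (intro sum.cong) (auto simp: T_swap add.commute)
  finally have "S = 0" by simp
  then show "chevalley_differential bracket p \<Omega> Ys = 0" using S by simp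
qed (rule alt)

subsection \<open>Traces of standard polynomials\<close>

text \<open>Leibniz rule for the derivation \<open>commutator X\<close>. The induction rests on
  [X, Z] P + Z [X, P] = [X, Z P], and the empty product 1 commutes with \<open>X\<close>.\<close>

lemma sum_prod_list_commutator:
  fixes Zs :: "'a::{ring, monoid_mult} list"
  shows "(\<Sum>j<length Zs. prod_list (Zs[j := commutator X (Zs ! j)])) = commutator X (prod_list Zs)"
proof (induction Zs)
  case Nil
  then show ?case by (simp add: commutator_def)
next
  case (Cons Z Zs)
  have "(\<Sum>j<length (Z # Zs). prod_list ((Z # Zs)[j := commutator X ((Z # Zs) ! j)])) =
      commutator X Z * prod_list Zs + Z * commutator X (prod_list Zs)"
    by (simp add: sum.lessThan_Suc_shift Cons.IH sum_distrib_left[symmetric] del: sum.lessThan_Suc)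
  then show ?case by (simp add: commutator_def algebra_simps)
qed

locale traced_algebra = complex_algebra scale
  for scale :: "complex \<Rightarrow> 'a::{ring, monoid_mult} \<Rightarrow> 'a" +
  fixes Tr :: "'a \<Rightarrow> complex"
  assumes is_trace: "is_trace scale Tr"
begin

sublocale Tr: Vector_Spaces.linear scale "(*)" Tr
  using is_trace unfolding is_trace_def by blast

lemma Tr_commute: "Tr (X * Y) = Tr (Y * X)"
  using is_trace unfolding is_trace_def by blast

lemma Tr_standard_poly:
  "Tr (standard_poly scale p Ys) =
    (\<Sum>\<sigma> | \<sigma> permutes {..<p}. of_int (sign \<sigma>) * Tr (prod_list (permute_list \<sigma> Ys)))"
  unfolding standard_poly_def by (simp add: Tr.sum Tr.scale)

text \<open>Permuting by \<open>\<tau>\<close> and then by \<open>\<sigma>\<close> is permuting by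
  \<open>\<tau> \<circ> \<sigma>\<close>, so the sum is reindexed by composition on the left; the
  sign comes out because the square of \<open>sign \<tau>\<close> is 1.\<close>

lemma Tr_standard_poly_permute_list:
  assumes "length Ys = p" "\<tau> permutes {..<p}"
  shows "Tr (standard_poly scale p (permute_list \<tau> Ys)) =
    of_int (sign \<tau>) * Tr (standard_poly scale p Ys)"
proof -
  let ?f = "\<lambda>\<sigma>. of_int (sign \<sigma>) * Tr (prod_list (permute_list \<sigma> Ys))"
  have "of_int (sign \<tau>) * Tr (standard_poly scale p Ys) =
      of_int (sign \<tau>) * (\<Sum>\<sigma> | \<sigma> permutes {..<p}. ?f (\<tau> \<circ> \<sigma>))"
    unfolding Tr_standard_poly
    by (rule arg_cong[OF setum_permutations_compose_left[OF assms(2)]])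
  also have "\<dots> = (\<Sum>\<sigma> | \<sigma> permutes {..<p}. of_int (sign \<tau>) * ?f (\<tau> \<circ> \<sigma>))"
    by (simp add: sum_distrib_left)
  also have "\<dots> = Tr (standard_poly scale p (permute_list \<tau> Ys))"
    unfolding Tr_standard_poly
  proof (rule sum.cong[OF refl])
    fix \<sigma> assume "\<sigma> \<in> {\<sigma>. \<sigma> permutes {..<p}}"
    then have \<sigma>: "\<sigma> permutes {..<p}" by simp
    have "permutation \<sigma>" "permutation \<tau>"
      using \<sigma> assms(2) by (auto intro: permutation_permutes[THEN iffD2])
    then have "of_int (sign \<tau>) * of_int (sign (\<tau> \<circ> \<sigma>)) = (of_int (sign \<sigma>) :: complex)"
      by (auto simp: sign_compose) (simp add: sign_def)
    moreover have "permute_list (\<tau> \<circ> \<sigma>) Ys = permute_list \<sigma> (permute_list \<tau> Ys)"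
      using \<sigma> assms(1) by (simp add: permute_list_compose)
    ultimately show "of_int (sign \<tau>) * ?f (\<tau> \<circ> \<sigma>) =
        of_int (sign \<sigma>) * Tr (prod_list (permute_list \<sigma> (permute_list \<tau> Ys)))"
      by (simp flip: mult.assoc)
  qed
  finally show ?thesis ..
qed

text \<open>Reindexing by composition with the full cycle on the right moves the first factor of
  every product to the end. The trace does not see this rotation, while the sign changes, so the sum
  equals its own negative. Degree 0 is excluded because there the value is
  \<open>Tr 1\<close>.\<close>

lemma Tr_standard_poly_even:
  assumes "even p" "p > 0" "length Ys = p"
  shows "Tr (standard_poly scale p Ys) = 0"
proof -
  let ?f = "\<lambda>\<sigma>. of_int (sign \<sigma>) * Tr (prod_list (permute_list \<sigma> Ys))"
  obtain \<rho> where \<rho>: "\<rho> permutes {..<p}" "sign \<rho> = (-1) ^ (p - 1)"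
    "\<And>y xs. length xs = p - 1 \<Longrightarrow> permute_list \<rho> (y # xs) = xs @ [y :: 'a]"
  proof -
    \<comment> \<open>With an empty trailing list, moving the head is a rotation of the whole
      list.\<close>
    obtain \<rho> where \<rho>: "\<rho> permutes {..<Suc (p - 1 + 0)}" "sign \<rho> = (-1) ^ (p - 1)"
      "\<And>y :: 'a. \<And>xs zs. length xs = p - 1 \<Longrightarrow> length zs = 0 \<Longrightarrow>
        permute_list \<rho> (y # xs @ zs) = xs @ y # zs"
      using ex_permute_list_move_front by blast
    show thesis
      using \<rho>(1,2) \<rho>(3)[of _ "[]"] assms(2) by (intro that[of \<rho>]) simp_all
  qed
  have "Tr (standard_poly scale p Ys) = (\<Sum>\<sigma> | \<sigma> permutes {..<p}. ?f (\<sigma> \<circ> \<rho>))"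
    unfolding Tr_standard_poly
    by (rule sum_permutations_compose_right[OF \<rho>(1)])
  also have "\<dots> = (\<Sum>\<sigma> | \<sigma> permutes {..<p}. - ?f \<sigma>)"
  proof (rule sum.cong[OF refl])
    fix \<sigma> assume "\<sigma> \<in> {\<sigma>. \<sigma> permutes {..<p}}"
    then have \<sigma>: "\<sigma> permutes {..<p}" by simp
    have "permutation \<sigma>" "permutation \<rho>"
      using \<sigma> \<rho>(1) by (auto intro: permutation_permutes[THEN iffD2])
    then have sgn: "sign (\<sigma> \<circ> \<rho>) = - sign \<sigma>"
      using assms(1,2) by (simp add: sign_compose \<rho>(2))
    obtain y xs where yxs: "permute_list \<sigma> Ys = y # xs"
      using assms(2,3) by (cases "permute_list \<sigma> Ys") (auto dest: arg_cong[of _ _ length])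
    then have "length xs = p - 1"
      using assms(3) by (metis length_permute_list length_Cons diff_Suc_1)
    then have "permute_list (\<sigma> \<circ> \<rho>) Ys = xs @ [y]"
      using \<rho>(1,3) assms(3) yxs by (simp add: permute_list_compose)
    then show "?f (\<sigma> \<circ> \<rho>) = - ?f \<sigma>"
      by (simp add: sgn yxs Tr_commute)
  qed
  also have "\<dots> = - Tr (standard_poly scale p Ys)"
    by (simp add: Tr_standard_poly sum_negf)
  finally show ?thesis by simp
qed

lemma linear_Tr_standard_poly:
  assumes "length Ys = p" "i < p"
  shows "Vector_Spaces.linear scale (*) (\<lambda>X. Tr (standard_poly scale p (Ys[i := X])))"
proof -
  \<comment> \<open>In the summand of \<open>\<sigma>\<close>, the argument of slot \<open>i\<close>
    appears as the factor at position \<open>inv \<sigma> i\<close>. The products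
    \<open>L \<sigma>\<close> and \<open>R \<sigma>\<close> on its two sides do not involve it,
    which makes linearity visible.\<close>
  define L where "L \<sigma> = prod_list (take (inv \<sigma> i) (permute_list \<sigma> Ys))" for \<sigma>
  define R where "R \<sigma> = prod_list (drop (Suc (inv \<sigma> i)) (permute_list \<sigma> Ys))" for \<sigma>
  have "Tr (standard_poly scale p (Ys[i := X])) =
      (\<Sum>\<sigma> | \<sigma> permutes {..<p}. of_int (sign \<sigma>) * Tr (L \<sigma> * X * R \<sigma>))" for X
    unfolding Tr_standard_poly
  proof (rule sum.cong[OF refl])
    fix \<sigma> assume "\<sigma> \<in> {\<sigma>. \<sigma> permutes {..<p}}"
    then have \<sigma>: "\<sigma> permutes {..<p}" by simp
    have j: "inv \<sigma> i < p" "\<sigma> (inv \<sigma> i) = i"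
      using permutes_in_image[OF permutes_inv[OF \<sigma>]] permutes_inverses(1)[OF \<sigma>] assms(2) by auto
    have "permute_list \<sigma> (Ys[i := X]) = (permute_list \<sigma> Ys)[inv \<sigma> i := X]"
      using permute_list_list_update[of \<sigma> Ys "inv \<sigma> i" X] \<sigma> j assms(1) by simp
    then show "of_int (sign \<sigma>) * Tr (prod_list (permute_list \<sigma> (Ys[i := X]))) =
        of_int (sign \<sigma>) * Tr (L \<sigma> * X * R \<sigma>)"
      using j assms(1) by (simp add: prod_list_list_update L_def R_def)
  qed
  moreover have "Vector_Spaces.linear scale (*)
      (\<lambda>X. \<Sum>\<sigma> | \<sigma> permutes {..<p}. of_int (sign \<sigma>) * Tr (L \<sigma> * X * R \<sigma>))"
    by (unfold_locales,
        simp_all add: distrib_left distrib_right scale_mult_left scale_mult_right Tr.add Tr.scale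
          sum.distrib sum_distrib_left)
      (simp add: mult.commute)
  ultimately show ?thesis by simp
qed

lemma Tr_standard_poly_alternating:
  "Tr \<circ> standard_poly scale p \<in> alternating_forms scale p"
  unfolding alternating_forms_def
  by (simp add: linear_Tr_standard_poly Tr_standard_poly_permute_list)

text \<open>The cancellation takes place separately for each permutation: by the Leibniz rule the
  sum over the slots is the trace of one commutator.\<close>

lemma Tr_standard_poly_invariant:
  "is_invariant_form commutator p (Tr \<circ> standard_poly scale p)"
  unfolding is_invariant_form_def comp_def
proof (intro allI impI)
  fix X and Ys :: "'a list" assume len: "length Ys = p"
  have "(\<Sum>i<p. Tr (standard_poly scale p (Ys[i := commutator X (Ys ! i)]))) =
      (\<Sum>\<sigma> | \<sigma> permutes {..<p}. of_int (sign \<sigma>) *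
        (\<Sum>i<p. Tr (prod_list (permute_list \<sigma> (Ys[i := commutator X (Ys ! i)])))))"
    unfolding Tr_standard_poly sum_distrib_left by (rule sum.swap)
  also have "\<dots> = 0"
  proof (rule sum.neutral, rule ballI)
    fix \<sigma> assume "\<sigma> \<in> {\<sigma>. \<sigma> permutes {..<p}}"
    then have \<sigma>: "\<sigma> permutes {..<p}" by simp
    let ?Zs = "permute_list \<sigma> Ys"
    \<comment> \<open>Substituting \<open>i = \<sigma> j\<close> numbers the slots by their place in
      the permuted product, as the Leibniz rule requires.\<close>
    have "(\<Sum>i<p. Tr (prod_list (permute_list \<sigma> (Ys[i := commutator X (Ys ! i)])))) =
        (\<Sum>j<p. Tr (prod_list (permute_list \<sigma> (Ys[\<sigma> j := commutator X (Ys ! \<sigma> j)]))))"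
      using sum.permute[OF \<sigma>] by (simp add: comp_def)
    also have "\<dots> = (\<Sum>j<p. Tr (prod_list (?Zs[j := commutator X (?Zs ! j)])))"
      using \<sigma> len by (simp add: permute_list_list_update permute_list_nth)
    also have "\<dots> = Tr (commutator X (prod_list ?Zs))"
      using sum_prod_list_commutator[of ?Zs X] len by (simp flip: Tr.sum)
    also have "\<dots> = 0"
      by (simp add: commutator_def Tr.diff Tr_commute[of X])
    finally show "of_int (sign \<sigma>) *
        (\<Sum>i<p. Tr (prod_list (permute_list \<sigma> (Ys[i := commutator X (Ys ! i)])))) = 0"
      by simp
  qed
  finally show "(\<Sum>i<p. Tr (standard_poly scale p (Ys[i := commutator X (Ys ! i)]))) = 0" .
qed

end

theorem proposition4p3p6:
  fixes scale :: "complex \<Rightarrow> 'a::{ring, monoid_mult} \<Rightarrow> 'a"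
    and Tr :: "'a \<Rightarrow> complex"
  assumes "complex_algebra scale"
    and "is_trace scale Tr"
  shows "(\<forall>k\<ge>1. \<forall>Ys. length Ys = 2 * k \<longrightarrow> (Tr \<circ> standard_poly scale (2 * k)) Ys = 0) \<and>
    (\<forall>k. is_cocycle scale commutator (2 * k + 1) (Tr \<circ> standard_poly scale (2 * k + 1)) \<and>
      is_invariant_form commutator (2 * k + 1) (Tr \<circ> standard_poly scale (2 * k + 1)))"
proof -
  interpret traced_algebra scale Tr
    using assms by (simp add: traced_algebra_def traced_algebra_axioms_def)
  \<comment> \<open>Alternation and invariance hold in every degree; parity enters only in the
    vanishing statement.\<close>
  have "is_cocycle scale commutator p (Tr \<circ> standard_poly scale p)" for p
    by (rule invariant_alternating_form_is_cocycle[OF Tr_standard_poly_alternating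
          Tr_standard_poly_invariant]) (simp add: commutator_def)
  then show ?thesis
    using Tr_standard_poly_even Tr_standard_poly_invariant by simp
qed

end
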